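(* Let $d\geq 1$, $T>0$, $x_0\in\mathbb{R}^d$, let $N$ be a positive integer and $\Delta t=T/N$. Let $F$ be a function from $\mathbb{R}^d$ into the non-empty compact subsets of $\mathbb{R}^d$ (not necessarily convex), and let $K,L\ge 0$ be constants such that $$|y|\leq K\quad\text{for all } y\in\bigcup_{x\in\mathbb{R}^d}F(x),\qquad \mathcal{H}\big(F(x),F(y)\big)\leq L|x-y|\quad\text{for all }x,y\in\mathbb{R}^d .$$ Assume that $x:[0,T]\to\mathbb{R}^d$ is a solution to the differential inclusion $x'(t)\in F(x(t))$, $x(0)=x_0$. Then there exists a sequence $\{\xi_n\}_{n=0}^N$ in $\mathbb{R}^d$ solving the Forward Euler scheme $$\xi_{n+1}\in\xi_n+\Delta t\,F(\xi_n),\quad n=0,1,\ldots,N-1,\qquad \xi_0=x_0,$$ such that $$\max_{0\leq n\leq N}|x(n\Delta t)-\xi_n|\leq K\big(e^{LT}d(d+1)+2d+LTe^{LT}\big)\Delta t .$$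
   Context: $|\cdot|$ is the Euclidean norm on $\mathbb{R}^d$ and $B$ is the closed unit ball in $\mathbb{R}^d$. For sets $C,D\subset\mathbb{R}^d$, $C+D=\{c+d \mid c\in C, d\in D\}$; for $\lambda\ge 0$, $\lambda C=\{\lambda c\mid c\in C\}$; for $c\in\mathbb{R}^d$, $c+C=\{c\}+C$. The Hausdorff distance between non-empty compact sets is $\mathcal{H}(C,D)=\inf\{\lambda\geq 0\mid C\subset D+\lambda B\text{ and }D\subset C+\lambda B\}$. A solution to the differential inclusion is an absolutely continuous function $x:[0,T]\to\mathbb{R}^d$ with $x(0)=x_0$ and $x'(t)\in F(x(t))$ for almost every $t\in[0,T]$. *)

theory Defs
  imports "HOL-Analysis.Analysis"
begin

(* Sums of sets are those of HOL-Library.Set_Algebras: C + D for sets, c +o C for a translate. *)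

definition scale_set :: "real \<Rightarrow> 'a::real_vector set \<Rightarrow> 'a set" where
  "scale_set r C = (\<lambda>c. r *\<^sub>R c) ` C"

(* Meaningful for non-empty bounded sets only; otherwise the infimum may be over the empty set. *)
definition hausdorff_distance :: "'a::real_normed_vector set \<Rightarrow> 'a set \<Rightarrow> real" where
  "hausdorff_distance C D =
     Inf {r. 0 \<le> r \<and> C \<subseteq> D + scale_set r (cball 0 1) \<and> D \<subseteq> C + scale_set r (cball 0 1)}"

(* Not to be confused with absolutely_continuous of HOL-Analysis.Radon_Nikodym, which relates
   measures. A pair (u, v) in P stands for the open interval from u to v; as u < v, disjoint
   intervals are distinct pairs, so finite sets suffice in place of finite families. *)
definition abs_continuous_on_interval ::
    "real \<Rightarrow> real \<Rightarrow> (real \<Rightarrow> 'a::real_normed_vector) \<Rightarrow> bool" where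
  "abs_continuous_on_interval a b f \<longleftrightarrow>
     (\<forall>\<epsilon>>0. \<exists>\<delta>>0. \<forall>P :: (real \<times> real) set.
        finite P \<longrightarrow>
        (\<forall>(u, v)\<in>P. a \<le> u \<and> u < v \<and> v \<le> b) \<longrightarrow>
        pairwise (\<lambda>(u, v) (u', v'). {u<..<v} \<inter> {u'<..<v'} = {}) P \<longrightarrow>
        (\<Sum>(u, v)\<in>P. v - u) < \<delta> \<longrightarrow>
        (\<Sum>(u, v)\<in>P. norm (f v - f u)) < \<epsilon>)"

(* The solution is a function on [0,T]: values of x outside that interval play no role. *)
definition differential_inclusion_solution ::
    "('a::real_normed_vector \<Rightarrow> 'a set) \<Rightarrow> 'a \<Rightarrow> real \<Rightarrow> (real \<Rightarrow> 'a) \<Rightarrow> bool" where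
  "differential_inclusion_solution F x\<^sub>0 T x \<longleftrightarrow>
     abs_continuous_on_interval 0 T x \<and> x 0 = x\<^sub>0 \<and>
     (AE t in lebesgue_on {0..T}.
        \<exists>v\<in>F (x t). (x has_vector_derivative v) (at t within {0..T}))"

definition forward_euler_solution ::
    "('a::real_vector \<Rightarrow> 'a set) \<Rightarrow> 'a \<Rightarrow> real \<Rightarrow> nat \<Rightarrow> (nat \<Rightarrow> 'a) \<Rightarrow> bool" where
  "forward_euler_solution F x\<^sub>0 h N \<xi> \<longleftrightarrow>
     \<xi> 0 = x\<^sub>0 \<and> (\<forall>n<N. \<xi> (Suc n) \<in> \<xi> n +o scale_set h (F (\<xi> n)))"

end

theory Submission
  imports Defs
begin

text \<open>The mean slope of a solution over a grid interval lies in \<open>convex hull F (x (t\<^sub>n))\<close> up to an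
  error \<open>L * K * \<Delta>t\<close>. By the selection theorem of Barany and Grinberg, the resulting points of the
  convex hulls can be replaced by points \<open>y\<^sub>n \<in> F (x (t\<^sub>n))\<close> such that all partial sums change by at
  most \<open>2 * d * K\<close>. The Euler scheme always steps along the point of \<open>F (\<xi>\<^sub>n)\<close> closest to \<open>y\<^sub>n\<close>,
  so the Lipschitz condition and a discrete Gronwall argument bound the error by
  \<open>K * (2 * d + L * T) * exp (L * T) * \<Delta>t\<close>; finally \<open>2 * d \<le> d * (d + 1)\<close>.\<close>

section \<open>Absolutely continuous functions\<close>

lemma abs_continuous_on_intervalE:
  assumes "abs_continuous_on_interval a b f" "\<epsilon> > 0"
  obtains \<delta> where "\<delta> > 0" "\<And>P :: (real \<times> real) set. finite P \<Longrightarrow>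
        (\<forall>(u, v)\<in>P. a \<le> u \<and> u < v \<and> v \<le> b) \<Longrightarrow>
        pairwise (\<lambda>(u, v) (u', v'). {u<..<v} \<inter> {u'<..<v'} = {}) P \<Longrightarrow>
        (\<Sum>(u, v)\<in>P. v - u) < \<delta> \<Longrightarrow> (\<Sum>(u, v)\<in>P. norm (f v - f u)) < \<epsilon>"
  using assms(1)[unfolded abs_continuous_on_interval_def, rule_format, OF assms(2)]
  by (elim exE conjE) (rule that; blast)

lemma abs_continuous_on_interval_subset:
  assumes "abs_continuous_on_interval a b f" "a \<le> c" "d \<le> b"
  shows "abs_continuous_on_interval c d f"
  unfolding abs_continuous_on_interval_def
proof (intro allI impI)
  fix \<epsilon> :: real assume "\<epsilon> > 0"
  obtain \<delta> where \<delta>: "\<delta> > 0" "\<And>P :: (real \<times> real) set. finite P \<Longrightarrow>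
        (\<forall>(u, v)\<in>P. a \<le> u \<and> u < v \<and> v \<le> b) \<Longrightarrow>
        pairwise (\<lambda>(u, v) (u', v'). {u<..<v} \<inter> {u'<..<v'} = {}) P \<Longrightarrow>
        (\<Sum>(u, v)\<in>P. v - u) < \<delta> \<Longrightarrow> (\<Sum>(u, v)\<in>P. norm (f v - f u)) < \<epsilon>"
    by (rule abs_continuous_on_intervalE[OF assms(1) \<open>\<epsilon> > 0\<close>]) blast
  show "\<exists>\<delta>>0. \<forall>P :: (real \<times> real) set. finite P \<longrightarrow>
        (\<forall>(u, v)\<in>P. c \<le> u \<and> u < v \<and> v \<le> d) \<longrightarrow>
        pairwise (\<lambda>(u, v) (u', v'). {u<..<v} \<inter> {u'<..<v'} = {}) P \<longrightarrow>
        (\<Sum>(u, v)\<in>P. v - u) < \<delta> \<longrightarrow> (\<Sum>(u, v)\<in>P. norm (f v - f u)) < \<epsilon>"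
    using \<delta>(1) assms(2,3) by (intro exI[of _ \<delta>] conjI allI impI \<delta>(2)) fastforce+
qed

lemma abs_continuous_on_interval_inner:
  assumes "abs_continuous_on_interval a b (f :: real \<Rightarrow> 'a::real_inner)"
  shows "abs_continuous_on_interval a b (\<lambda>t. p \<bullet> f t)"
  unfolding abs_continuous_on_interval_def
proof (intro allI impI)
  fix \<epsilon> :: real assume "\<epsilon> > 0"
  \<comment> \<open>The summand 1 keeps the divisor positive when \<open>p = 0\<close>; the factor
    \<open>norm p\<close> itself comes from Cauchy-Schwarz.\<close>
  then have "\<epsilon> / (norm p + 1) > 0" by (simp add: add_nonneg_pos)
  then obtain \<delta> where \<delta>: "\<delta> > 0" "\<And>P :: (real \<times> real) set. finite P \<Longrightarrow>
        (\<forall>(u, v)\<in>P. a \<le> u \<and> u < v \<and> v \<le> b) \<Longrightarrow>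
        pairwise (\<lambda>(u, v) (u', v'). {u<..<v} \<inter> {u'<..<v'} = {}) P \<Longrightarrow>
        (\<Sum>(u, v)\<in>P. v - u) < \<delta> \<Longrightarrow> (\<Sum>(u, v)\<in>P. norm (f v - f u)) < \<epsilon> / (norm p + 1)"
    by (rule abs_continuous_on_intervalE[OF assms]) blast
  have "(\<Sum>(u, v)\<in>P. norm (p \<bullet> f v - p \<bullet> f u)) < \<epsilon>"
    if P: "finite P" "\<forall>(u, v)\<in>P. a \<le> u \<and> u < v \<and> v \<le> b"
      "pairwise (\<lambda>(u, v) (u', v'). {u<..<v} \<inter> {u'<..<v'} = {}) P"
      "(\<Sum>(u, v)\<in>P. v - u) < \<delta>" for P :: "(real \<times> real) set"
  proof -
    have "(\<Sum>(u, v)\<in>P. norm (p \<bullet> f v - p \<bullet> f u)) \<le> (\<Sum>(u, v)\<in>P. (norm p + 1) * norm (f v - f u))"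
    proof (intro sum_mono, clarify)
      fix u v
      have "norm (p \<bullet> f v - p \<bullet> f u) \<le> norm p * norm (f v - f u)"
        by (simp add: Cauchy_Schwarz_ineq2 flip: inner_diff_right)
      also have "\<dots> \<le> (norm p + 1) * norm (f v - f u)"
        by (intro mult_right_mono) auto
      finally show "norm (p \<bullet> f v - p \<bullet> f u) \<le> (norm p + 1) * norm (f v - f u)" .
    qed
    also have "\<dots> = (norm p + 1) * (\<Sum>(u, v)\<in>P. norm (f v - f u))"
      by (simp add: sum_distrib_left case_prod_unfold)
    also have "\<dots> < (norm p + 1) * (\<epsilon> / (norm p + 1))"
      by (intro mult_strict_left_mono \<delta>(2)[OF P]) (simp add: add_nonneg_pos)
    also have "\<dots> = \<epsilon>"
      using add_nonneg_pos[OF norm_ge_zero[of p] zero_less_one] by simp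
    finally show ?thesis .
  qed
  with \<delta>(1) show "\<exists>\<delta>>0. \<forall>P :: (real \<times> real) set. finite P \<longrightarrow>
        (\<forall>(u, v)\<in>P. a \<le> u \<and> u < v \<and> v \<le> b) \<longrightarrow>
        pairwise (\<lambda>(u, v) (u', v'). {u<..<v} \<inter> {u'<..<v'} = {}) P \<longrightarrow>
        (\<Sum>(u, v)\<in>P. v - u) < \<delta> \<longrightarrow> (\<Sum>(u, v)\<in>P. norm (p \<bullet> f v - p \<bullet> f u)) < \<epsilon>"
    by blast
qed

section \<open>Increments and mean values of absolutely continuous functions\<close>

text \<open>This is a one-sided straddle estimate. Since \<open>u\<close> and \<open>v\<close> lie
  on opposite sides of \<open>t\<close>, the two linearisation errors are at most
  \<open>\<epsilon> * (t - u)\<close> and \<open>\<epsilon> * (v - t)\<close> and add up to exactly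
  \<open>\<epsilon> * (v - u)\<close>.\<close>

lemma has_vector_derivative_diff_quotient_le:
  fixes g :: "real \<Rightarrow> real"
  assumes "(g has_vector_derivative D) (at t within S)" "\<epsilon> > 0"
  obtains d where "d > 0"
    "\<And>u v. u \<in> S \<Longrightarrow> v \<in> S \<Longrightarrow> u \<le> t \<Longrightarrow> t \<le> v \<Longrightarrow> u \<in> ball t d \<Longrightarrow> v \<in> ball t d \<Longrightarrow>
       g v - g u \<le> (D + \<epsilon>) * (v - u)"
proof -
  obtain d where d: "d > 0"
    "\<And>y. y \<in> S \<Longrightarrow> norm (y - t) < d \<Longrightarrow> norm (g y - g t - (y - t) *\<^sub>R D) \<le> \<epsilon> * norm (y - t)"
    using assms(1)[unfolded has_vector_derivative_def has_derivative_within_alt] assms(2) by blast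
  show ?thesis
  proof
    fix u v assume uv: "u \<in> S" "v \<in> S" "u \<le> t" "t \<le> v" "u \<in> ball t d" "v \<in> ball t d"
    have "\<bar>g v - g t - (v - t) * D\<bar> \<le> \<epsilon> * (v - t)" "\<bar>g u - g t - (u - t) * D\<bar> \<le> \<epsilon> * (t - u)"
      using d(2)[of v] d(2)[of u] uv by (auto simp: dist_real_def)
    then show "g v - g u \<le> (D + \<epsilon>) * (v - u)"
      by (simp add: algebra_simps abs_le_iff)
  qed (use d in auto)
qed

text \<open>A gauge for which the tags in the null set only contribute little total length exists
  because the indicator of a null set has Henstock--Kurzweil integral 0; Cousin's lemma does the rest.\<close>

lemma abs_continuous_on_interval_increment_le:
  fixes g :: "real \<Rightarrow> real"
  assumes ac: "abs_continuous_on_interval a b g" and "a \<le> b" and E: "negligible E"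
    and der: "\<And>t. t \<in> {a..b} - E \<Longrightarrow> \<exists>D\<le>M. (g has_vector_derivative D) (at t within {a..b})"
  shows "g b - g a \<le> M * (b - a)"
proof -
  \<comment> \<open>The first error term comes from tags outside \<open>E\<close>. The other two
    come from tags in \<open>E\<close>: one for the variation of \<open>g\<close> over their
    intervals, one for \<open>M\<close> times the total length of these.\<close>
  have main: "g b - g a - M * (b - a) \<le> \<epsilon> * (b - a) + \<epsilon> + \<epsilon>" if "\<epsilon> > 0" for \<epsilon>
  proof -
    obtain \<delta> where \<delta>: "\<delta> > 0" "\<And>P :: (real \<times> real) set. finite P \<Longrightarrow>
        (\<forall>(u, v)\<in>P. a \<le> u \<and> u < v \<and> v \<le> b) \<Longrightarrow>
        pairwise (\<lambda>(u, v) (u', v'). {u<..<v} \<inter> {u'<..<v'} = {}) P \<Longrightarrow>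
        (\<Sum>(u, v)\<in>P. v - u) < \<delta> \<Longrightarrow> (\<Sum>(u, v)\<in>P. norm (g v - g u)) < \<epsilon>"
      by (rule abs_continuous_on_intervalE[OF ac \<open>\<epsilon> > 0\<close>]) blast
    \<comment> \<open>The bound by \<open>\<delta>\<close> lets absolute continuity control the
      variation over the tags in \<open>E\<close>; the bound by
      \<open>\<epsilon> / (\<bar>M\<bar> + 1)\<close> makes \<open>\<bar>M\<bar>\<close> times their
      total length at most \<open>\<epsilon>\<close>.\<close>
    define \<delta>' where "\<delta>' = min \<delta> (\<epsilon> / (\<bar>M\<bar> + 1))"
    have "\<delta>' > 0" using \<delta>(1) \<open>\<epsilon> > 0\<close> by (auto simp: \<delta>'_def)
    have int: "(indicat_real E has_integral 0) (cbox a b)"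
      using E unfolding negligible_def by blast
    have "\<exists>\<gamma>. gauge \<gamma> \<and> (\<forall>p. p tagged_division_of cbox a b \<and> \<gamma> fine p \<longrightarrow>
        norm ((\<Sum>(t,k)\<in>p. measure lborel k *\<^sub>R indicat_real E t) - 0) < \<delta>')"
      by (rule has_integral[THEN iffD1, OF int, THEN spec, THEN mp, OF \<open>\<delta>' > 0\<close>])
    then obtain \<gamma> where \<gamma>: "gauge \<gamma>" and
      \<gamma>_fine: "\<forall>p. p tagged_division_of cbox a b \<and> \<gamma> fine p \<longrightarrow>
        norm ((\<Sum>(t,k)\<in>p. measure lborel k *\<^sub>R indicat_real E t) - 0) < \<delta>'"
      by (elim exE conjE)
    \<comment> \<open>A gauge needs a positive radius at every point, so \<open>d > 0\<close> is
      demanded of all \<open>t\<close>; points of \<open>E\<close> and points outside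
      \<open>{a..b}\<close> carry no further demand.\<close>
    define Q where "Q t d \<longleftrightarrow> d > 0 \<and> (t \<in> {a..b} - E \<longrightarrow>
      (\<forall>u\<in>{a..b} \<inter> ball t d. \<forall>v\<in>{a..b} \<inter> ball t d. u \<le> t \<longrightarrow> t \<le> v \<longrightarrow>
        g v - g u \<le> (M + \<epsilon>) * (v - u)))" for t d
    have "\<exists>d. Q t d" for t
    proof (cases "t \<in> {a..b} - E")
      case True
      then obtain D where D: "D \<le> M" "(g has_vector_derivative D) (at t within {a..b})"
        using der by blast
      obtain d where d: "d > 0"
        "\<And>u v. u \<in> {a..b} \<Longrightarrow> v \<in> {a..b} \<Longrightarrow> u \<le> t \<Longrightarrow> t \<le> v \<Longrightarrow> u \<in> ball t d \<Longrightarrow> v \<in> ball t d \<Longrightarrow>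
           g v - g u \<le> (D + \<epsilon>) * (v - u)"
        by (rule has_vector_derivative_diff_quotient_le[OF D(2) \<open>\<epsilon> > 0\<close>]) (rule that; blast)
      have "g v - g u \<le> (M + \<epsilon>) * (v - u)"
        if "u \<in> {a..b} \<inter> ball t d" "v \<in> {a..b} \<inter> ball t d" "u \<le> t" "t \<le> v" for u v
      proof -
        have "g v - g u \<le> (D + \<epsilon>) * (v - u)" using that by (intro d(2)) auto
        also have "\<dots> \<le> (M + \<epsilon>) * (v - u)"
          using D(1) that by (intro mult_right_mono) auto
        finally show ?thesis .
      qed
      then show ?thesis using d(1) unfolding Q_def by auto
    next
      case False
      then show ?thesis unfolding Q_def by (intro exI[of _ 1]) auto
    qed
    then obtain d where Q: "Q t (d t)" for t by metis
    then have d: "d t > 0" for t by (simp add: Q_def)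
    have "gauge (\<lambda>t. \<gamma> t \<inter> ball t (d t))"
      using \<gamma> d by (intro gauge_Int gauge_ball_dependent) auto
    then obtain p where p: "p tagged_division_of cbox a b" "(\<lambda>t. \<gamma> t \<inter> ball t (d t)) fine p"
      using fine_division_exists by blast
    then have fin: "finite p" and fine: "\<gamma> fine p" "(\<lambda>t. ball t (d t)) fine p"
      by (auto simp: fine_Int)
    have p_D: "\<exists>u v. k = {u..v} \<and> a \<le> u \<and> u \<le> t \<and> t \<le> v \<and> v \<le> b" if tk: "(t, k) \<in> p" for t k
    proof -
      obtain u v where k: "k = cbox u v" using tagged_division_ofD(4)[OF p(1) tk] by blast
      moreover have "t \<in> k" "k \<subseteq> cbox a b" using tagged_division_ofD(2,3)[OF p(1) tk] .
      ultimately show ?thesis by (intro exI[of _ u] exI[of _ v]) auto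
    qed
    define q where "q = {(t, k) \<in> p. t \<in> E}"
    \<comment> \<open>One-point intervals are dropped because absolute continuity speaks of pairs
      with \<open>u < v\<close>. They contribute 0 to both the length and the variation, so the sums
      over \<open>q\<close> and \<open>q'\<close> agree.\<close>
    define q' where "q' = {(t, k) \<in> q. Inf k < Sup k}"
    have "q \<subseteq> p" "q' \<subseteq> q" by (auto simp: q_def q'_def)
    then have "finite q" "finite q'" using fin by (meson finite_subset)+
    have content_p: "measure lborel k = Sup k - Inf k" if "(t, k) \<in> p" for t k
      using p_D[OF that] by auto
    have degenerate: "Sup k = Inf k" if "(t, k) \<in> q" "(t, k) \<notin> q'" for t k
      using p_D[of t k] that by (auto simp: q_def q'_def)
    define \<phi> :: "real \<times> real set \<Rightarrow> real \<times> real" where "\<phi> = (\<lambda>(t, k). (Inf k, Sup k))"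
    have disj: "{Inf k<..<Sup k} \<inter> {Inf k'<..<Sup k'} = {}"
      if "(t, k) \<in> p" "(t', k') \<in> p" "(t, k) \<noteq> (t', k')" for t k t' k'
      using tagged_division_ofD(5)[OF p(1) that(1,2)] p_D[OF that(1)] p_D[OF that(2)] that(3) by auto
    \<comment> \<open>Two tagged intervals with the same end points would share a non-empty
      interior, which \<open>disj\<close> excludes for distinct members of \<open>p\<close>.\<close>
    have inj: "inj_on \<phi> q'"
    proof (rule inj_onI, clarify)
      fix t k t' k' assume *: "(t, k) \<in> q'" "(t', k') \<in> q'" "\<phi> (t, k) = \<phi> (t', k')"
      then have "{Inf k<..<Sup k} \<inter> {Inf k'<..<Sup k'} \<noteq> {}"
        by (auto simp: \<phi>_def q'_def)
      then show "t = t' \<and> k = k'"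
        using disj * \<open>q' \<subseteq> q\<close> \<open>q \<subseteq> p\<close> by blast
    qed
    \<comment> \<open>The total length of the intervals tagged in \<open>E\<close> is the Riemann
      sum of the indicator of \<open>E\<close>, which the gauge \<open>\<gamma>\<close> makes
      small.\<close>
    have "(\<Sum>(t, k)\<in>q. measure lborel k) = (\<Sum>(t, k)\<in>p. measure lborel k *\<^sub>R indicat_real E t)"
      unfolding q_def using fin
      by (intro sum.mono_neutral_cong_left) (auto simp: indicator_def)
    also have "\<dots> < \<delta>'" using \<gamma>_fine[THEN spec, THEN mp, OF conjI, OF p(1) fine(1)] by simp
    finally have q_content: "(\<Sum>(t, k)\<in>q. measure lborel k) < \<delta>'" .
    have "(\<Sum>(u, v)\<in>\<phi> ` q'. v - u) = (\<Sum>(t, k)\<in>q'. Sup k - Inf k)"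
      by (subst sum.reindex[OF inj]) (auto simp: \<phi>_def case_prod_unfold)
    also have "\<dots> = (\<Sum>(t, k)\<in>q. Sup k - Inf k)"
      using \<open>finite q\<close> \<open>q' \<subseteq> q\<close> degenerate by (intro sum.mono_neutral_left) auto
    also have "\<dots> = (\<Sum>(t, k)\<in>q. measure lborel k)"
      using content_p \<open>q \<subseteq> p\<close> by (intro sum.cong) auto
    finally have len: "(\<Sum>(u, v)\<in>\<phi> ` q'. v - u) < \<delta>" using q_content by (simp add: \<delta>'_def)
    have "(\<Sum>(u, v)\<in>\<phi> ` q'. norm (g v - g u)) < \<epsilon>"
    proof (rule \<delta>(2)[OF _ _ _ len])
      show "\<forall>(u, v)\<in>\<phi> ` q'. a \<le> u \<and> u < v \<and> v \<le> b"
        using p_D \<open>q \<subseteq> p\<close> by (fastforce simp: \<phi>_def q'_def)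
      show "pairwise (\<lambda>(u, v) (u', v'). {u<..<v} \<inter> {u'<..<v'} = {}) (\<phi> ` q')"
      proof (rule pairwise_imageI)
        fix x y assume xy: "x \<in> q'" "y \<in> q'" "x \<noteq> y"
        obtain t k t' k' where "x = (t, k)" "y = (t', k')" by (metis surj_pair)
        then show "(case \<phi> x of (u, v) \<Rightarrow> \<lambda>(u', v'). {u<..<v} \<inter> {u'<..<v'} = {}) (\<phi> y)"
          using disj[of t k t' k'] xy \<open>q' \<subseteq> q\<close> \<open>q \<subseteq> p\<close> by (auto simp: \<phi>_def)
      qed
    qed (use \<open>finite q'\<close> in auto)
    also have "(\<Sum>(u, v)\<in>\<phi> ` q'. norm (g v - g u)) = (\<Sum>(t, k)\<in>q'. norm (g (Sup k) - g (Inf k)))"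
      by (subst sum.reindex[OF inj]) (auto simp: \<phi>_def case_prod_unfold)
    also have "\<dots> = (\<Sum>(t, k)\<in>q. norm (g (Sup k) - g (Inf k)))"
      using \<open>finite q\<close> \<open>q' \<subseteq> q\<close> degenerate by (intro sum.mono_neutral_left) auto
    finally have q_var: "(\<Sum>(t, k)\<in>q. norm (g (Sup k) - g (Inf k))) < \<epsilon>" .

    \<comment> \<open>Both the increment of \<open>g\<close> and the length are additive over the
      division, so the excess over slope \<open>M\<close> can be estimated interval by
      interval.\<close>
    have "g b - g a - M * (b - a) = (\<Sum>(t, k)\<in>p. g (Sup k) - g (Inf k)) - M * (\<Sum>(t, k)\<in>p. measure lborel k)"
      using additive_tagged_division_1[OF \<open>a \<le> b\<close>, of p g] p(1) \<open>a \<le> b\<close>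
        additive_content_tagged_division[OF p(1)] by simp
    also have "\<dots> = (\<Sum>(t, k)\<in>p. g (Sup k) - g (Inf k) - M * measure lborel k)"
      by (simp add: sum_distrib_left sum_subtractf case_prod_unfold)
    also have "\<dots> = (\<Sum>(t, k)\<in>p - q. g (Sup k) - g (Inf k) - M * measure lborel k)
                   + (\<Sum>(t, k)\<in>q. g (Sup k) - g (Inf k) - M * measure lborel k)"
      using fin \<open>q \<subseteq> p\<close> by (simp add: sum.subset_diff)
    also have "(\<Sum>(t, k)\<in>p - q. g (Sup k) - g (Inf k) - M * measure lborel k) \<le> (\<Sum>(t, k)\<in>p - q. \<epsilon> * measure lborel k)"
    proof (intro sum_mono, clarify)
      fix t k assume tk: "(t, k) \<in> p" "(t, k) \<notin> q"
      obtain u v where uv: "k = {u..v}" "a \<le> u" "u \<le> t" "t \<le> v" "v \<le> b" using p_D[OF tk(1)] by auto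
      have "k \<subseteq> ball t (d t)" using fine(2) tk(1) by (auto simp: fine_def)
      moreover have "u \<in> k" "v \<in> k" "t \<in> {a..b} - E" using uv tk by (auto simp: q_def)
      moreover have "u \<in> {a..b}" "v \<in> {a..b}" using uv by auto
      ultimately have "u \<in> {a..b} \<inter> ball t (d t)" "v \<in> {a..b} \<inter> ball t (d t)" "t \<in> {a..b} - E"
        by blast+
      with Q[of t, unfolded Q_def] have "g v - g u \<le> (M + \<epsilon>) * (v - u)"
        using \<open>u \<le> t\<close> \<open>t \<le> v\<close> by blast
      then show "g (Sup k) - g (Inf k) - M * measure lborel k \<le> \<epsilon> * measure lborel k"
        using uv by (simp add: algebra_simps)
    qed
    also have "\<dots> \<le> (\<Sum>(t, k)\<in>p. \<epsilon> * measure lborel k)"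
      using fin \<open>\<epsilon> > 0\<close> by (intro sum_mono2) auto
    also have "\<dots> = \<epsilon> * (b - a)"
      using additive_content_tagged_division[OF p(1)] \<open>a \<le> b\<close>
      by (simp add: case_prod_unfold flip: sum_distrib_left)
    also have "(\<Sum>(t, k)\<in>q. g (Sup k) - g (Inf k) - M * measure lborel k)
        \<le> (\<Sum>(t, k)\<in>q. norm (g (Sup k) - g (Inf k)) + \<bar>M\<bar> * measure lborel k)"
    proof (intro sum_mono, clarify)
      fix t and k :: "real set"
      have "- M * measure lborel k \<le> \<bar>M\<bar> * measure lborel k" by (intro mult_right_mono) auto
      then show "g (Sup k) - g (Inf k) - M * measure lborel k \<le> norm (g (Sup k) - g (Inf k)) + \<bar>M\<bar> * measure lborel k"
        by auto
    qed
    also have "\<dots> = (\<Sum>(t, k)\<in>q. norm (g (Sup k) - g (Inf k))) + \<bar>M\<bar> * (\<Sum>(t, k)\<in>q. measure lborel k)"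
      by (simp add: sum_distrib_left sum.distrib case_prod_unfold)
    also have "\<dots> \<le> \<epsilon> + \<epsilon>"
    proof -
      have "\<bar>M\<bar> * (\<Sum>(t, k)\<in>q. measure lborel k) \<le> \<bar>M\<bar> * (\<epsilon> / (\<bar>M\<bar> + 1))"
        using q_content by (intro mult_left_mono) (auto simp: \<delta>'_def)
      also have "\<dots> \<le> \<epsilon>" using \<open>\<epsilon> > 0\<close> by (simp add: field_simps)
      finally show ?thesis using q_var by simp
    qed
    finally show ?thesis by simp
  qed
  have "g b - g a - M * (b - a) \<le> e" if "e > 0" for e
  proof -
    define r where "r = e / (b - a + 2)"
    have "r > 0" "r * (b - a + 2) = e" using \<open>a \<le> b\<close> that by (simp_all add: r_def)
    then show ?thesis using main[of r] by (simp add: algebra_simps)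
  qed
  then show ?thesis using field_le_epsilon[of "g b - g a - M * (b - a)" 0] by simp
qed

text \<open>A mean slope outside \<open>C\<close> could be strictly separated from \<open>C\<close>
  by a hyperplane; the scalar increment bound along the normal of that hyperplane forbids
  this.\<close>

lemma abs_continuous_on_interval_mean_value:
  fixes x :: "real \<Rightarrow> 'a::euclidean_space"
  assumes ac: "abs_continuous_on_interval a b x" and "a < b" and E: "negligible E"
    and C: "closed C" "convex C"
    and der: "\<And>t. t \<in> {a..b} - E \<Longrightarrow> \<exists>v\<in>C. (x has_vector_derivative v) (at t within {a..b})"
  shows "(x b - x a) /\<^sub>R (b - a) \<in> C"
proof (rule ccontr)
  assume "(x b - x a) /\<^sub>R (b - a) \<notin> C"
  then obtain p c where pc: "p \<bullet> ((x b - x a) /\<^sub>R (b - a)) < c" "\<And>v. v \<in> C \<Longrightarrow> c < p \<bullet> v"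
    using separating_hyperplane_closed_point[OF C(2,1)] by blast
  \<comment> \<open>Separation bounds \<open>p \<bullet> v\<close> from below on \<open>C\<close>,
    whereas the increment lemma wants derivatives bounded from above; hence the sign.\<close>
  have "(- p) \<bullet> x b - (- p) \<bullet> x a \<le> - c * (b - a)"
  proof (rule abs_continuous_on_interval_increment_le[OF abs_continuous_on_interval_inner[OF ac] _ E])
    fix t assume "t \<in> {a..b} - E"
    then obtain v where v: "v \<in> C" "(x has_vector_derivative v) (at t within {a..b})"
      using der by blast
    have "((\<lambda>t. (- p) \<bullet> x t) has_vector_derivative (- p) \<bullet> v) (at t within {a..b})"
      by (rule bounded_linear.has_vector_derivative[OF bounded_linear_inner_right v(2)])
    then show "\<exists>D\<le>- c. ((\<lambda>t. (- p) \<bullet> x t) has_vector_derivative D) (at t within {a..b})"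
      using pc(2)[OF v(1)] by (intro exI[of _ "(- p) \<bullet> v"]) auto
  qed (use \<open>a < b\<close> in auto)
  then have "c * (b - a) \<le> p \<bullet> (x b - x a)"
    by (simp add: inner_diff_right)
  moreover have "(p \<bullet> (x b - x a)) / (b - a) < c"
    using pc(1) by (simp add: divide_inverse_commute)
  ultimately show False
    using \<open>a < b\<close> by (simp add: pos_divide_less_eq)
qed

section \<open>Vector selection\<close>

text \<open>Linear dependence is a property of sets and does not see repetitions in a family. An
  injective family is covered by the dimension bound, and a repeated vector gives the relation with
  coefficients 1 and -1.\<close>

lemma exists_linear_relation:
  fixes f :: "'i \<Rightarrow> 'a::euclidean_space"
  assumes "finite J" "card J > DIM('a)"
  obtains c where "\<exists>i\<in>J. c i \<noteq> 0" "(\<Sum>i\<in>J. c i *\<^sub>R f i) = 0"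
proof (cases "inj_on f J")
  case True
  then have "dependent (f ` J)"
    using assms by (intro dependent_biggerset) (simp add: card_image)
  then obtain u where u: "\<exists>v\<in>f ` J. u v \<noteq> 0" "(\<Sum>v\<in>f ` J. u v *\<^sub>R v) = 0"
    using dependent_finite[of "f ` J"] \<open>finite J\<close> by auto
  then have "(\<Sum>i\<in>J. u (f i) *\<^sub>R f i) = 0"
    using True by (simp add: sum.reindex)
  then show ?thesis using u(1) by (intro that[of "u \<circ> f"]) auto
next
  case False
  then obtain i j where ij: "i \<in> J" "j \<in> J" "i \<noteq> j" "f i = f j"
    by (auto simp: inj_on_def)
  let ?c = "\<lambda>k. if k = i then 1 else if k = j then - 1 else 0 :: real"
  have "(\<Sum>k\<in>J. ?c k *\<^sub>R f k) = (\<Sum>k\<in>{i, j}. ?c k *\<^sub>R f k)"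
    using ij \<open>finite J\<close> by (intro sum.mono_neutral_right) auto
  also have "\<dots> = 0" using ij by simp
  finally show ?thesis using ij by (intro that[of ?c]) auto
qed

lemma positive_family_hits_zero:
  fixes \<alpha> \<beta> :: "'p \<Rightarrow> real"
  assumes "finite P" "\<And>p. p \<in> P \<Longrightarrow> \<alpha> p > 0" "\<exists>p\<in>P. \<beta> p < 0"
  shows "\<exists>t. \<exists>p\<in>P. \<alpha> p + t * \<beta> p = 0 \<and> (\<forall>q\<in>P. \<alpha> q + t * \<beta> q \<ge> 0)"
proof -
  define N where "N = {p \<in> P. \<beta> p < 0}"
  have "finite N" "N \<noteq> {}" using assms by (auto simp: N_def)
  then obtain p where p: "p \<in> N" "\<And>q. q \<in> N \<Longrightarrow> \<alpha> p / - \<beta> p \<le> \<alpha> q / - \<beta> q"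
    using ex_min_if_finite[of "(\<lambda>q. \<alpha> q / - \<beta> q) ` N"] by (force simp: not_less)
  define t where "t = \<alpha> p / - \<beta> p"
  have "t \<ge> 0" using p(1) assms(2)[of p] by (auto simp: t_def N_def field_simps)
  show ?thesis
  proof (intro exI bexI conjI ballI)
    show "p \<in> P" "\<alpha> p + t * \<beta> p = 0" using p(1) by (auto simp: t_def N_def)
    fix q assume "q \<in> P"
    show "\<alpha> q + t * \<beta> q \<ge> 0"
    proof (cases "q \<in> N")
      case True
      then have "t \<le> \<alpha> q / - \<beta> q" "\<beta> q < 0" using p(2) by (auto simp: t_def N_def)
      then show ?thesis by (simp add: field_simps)
    next
      case False
      then have "\<beta> q \<ge> 0" using \<open>q \<in> P\<close> by (auto simp: N_def)
      then show ?thesis using \<open>t \<ge> 0\<close> assms(2)[OF \<open>q \<in> P\<close>] by simp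
    qed
  qed
qed

lemma convex_hull_remove_zero_weight:
  fixes S :: "'a::real_vector set"
  assumes "finite S" "p \<in> S" "\<And>v. v \<in> S \<Longrightarrow> u v \<ge> 0" "sum u S = 1" "u p = 0"
  shows "(\<Sum>v\<in>S. u v *\<^sub>R v) \<in> convex hull (S - {p})"
  unfolding convex_hull_finite[OF finite_Diff[OF \<open>finite S\<close>]]
  using assms by (auto simp: sum.remove[of S p] intro!: exI[of _ u])

text \<open>Choose two points in each set that is not a singleton. With more than
  \<open>DIM('a)\<close> such sets, their differences are linearly related, and shifting weights
  along the relation keeps the total sum and the sum of the weights in each set. The shift stops
  when some weight vanishes, and the point \<open>p\<close> carrying it can be removed.\<close>

lemma shapley_folkman_step:
  fixes S :: "'i \<Rightarrow> 'a::euclidean_space set"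
  assumes I: "finite I" and fin: "\<And>i. i \<in> I \<Longrightarrow> finite (S i)"
    and z: "\<And>i. i \<in> I \<Longrightarrow> z i \<in> convex hull S i"
    and card: "card {i \<in> I. \<not> is_singleton (S i)} > DIM('a)"
  obtains j p z' where "j \<in> I" "p \<in> S j" "\<And>i. i \<in> I \<Longrightarrow> z' i \<in> convex hull (S(j := S j - {p})) i"
    "(\<Sum>i\<in>I. z' i) = (\<Sum>i\<in>I. z i)"
proof -
  note result = that
  have "\<exists>u. (\<forall>v\<in>S i. 0 \<le> u v) \<and> sum u (S i) = 1 \<and> (\<Sum>v\<in>S i. u v *\<^sub>R v) = z i" if "i \<in> I" for i
    using z[OF that] unfolding convex_hull_finite[OF fin[OF that]] by blast
  then obtain \<alpha> where \<alpha>: "\<And>i v. i \<in> I \<Longrightarrow> v \<in> S i \<Longrightarrow> 0 \<le> \<alpha> i v" "\<And>i. i \<in> I \<Longrightarrow> sum (\<alpha> i) (S i) = 1"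
    "\<And>i. i \<in> I \<Longrightarrow> (\<Sum>v\<in>S i. \<alpha> i v *\<^sub>R v) = z i"
    by metis
  \<comment> \<open>It suffices to find convex weights with the same total sum, one of which is
    0.\<close>
  have *: thesis if "j \<in> I" "p \<in> S j" and \<alpha>': "\<And>i v. i \<in> I \<Longrightarrow> v \<in> S i \<Longrightarrow> 0 \<le> \<alpha>' i v"
    "\<And>i. i \<in> I \<Longrightarrow> sum (\<alpha>' i) (S i) = 1" "\<alpha>' j p = 0"
    "(\<Sum>i\<in>I. \<Sum>v\<in>S i. \<alpha>' i v *\<^sub>R v) = (\<Sum>i\<in>I. z i)" for j p \<alpha>'
  proof (rule result[OF \<open>j \<in> I\<close> \<open>p \<in> S j\<close> _ \<alpha>'(4)])
    fix i assume "i \<in> I"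
    show "(\<Sum>v\<in>S i. \<alpha>' i v *\<^sub>R v) \<in> convex hull (S(j := S j - {p})) i"
    proof (cases "i = j")
      case True
      then show ?thesis
        using convex_hull_remove_zero_weight[OF fin[OF \<open>j \<in> I\<close>] \<open>p \<in> S j\<close> \<alpha>'(1)[OF \<open>j \<in> I\<close>] \<alpha>'(2)[OF \<open>j \<in> I\<close>] \<alpha>'(3)]
        by simp
    next
      case False
      then show ?thesis
        using \<alpha>'(1,2)[OF \<open>i \<in> I\<close>] by (auto simp: convex_hull_finite[OF fin[OF \<open>i \<in> I\<close>]])
    qed
  qed
  show thesis
  proof (cases "\<exists>i\<in>I. \<exists>v\<in>S i. \<alpha> i v = 0")
    case True
    then show ?thesis using *[where \<alpha>' = \<alpha>] \<alpha> by auto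
  next
    case False
    then have pos: "\<alpha> i v > 0" if "i \<in> I" "v \<in> S i" for i v
      using \<alpha>(1)[OF that] that by (auto simp: less_le)
    define J where "J = {i \<in> I. \<not> is_singleton (S i)}"
    have "J \<subseteq> I" "finite J" using I by (auto simp: J_def)
    have "\<exists>a b. a \<in> S i \<and> b \<in> S i \<and> a \<noteq> b" if "i \<in> J" for i
    proof -
      have "S i \<noteq> {}" using z[of i] that by (auto simp: J_def)
      then show ?thesis using that is_singletonI'[of "S i"] by (auto simp: J_def)
    qed
    then obtain a b where ab: "\<And>i. i \<in> J \<Longrightarrow> a i \<in> S i" "\<And>i. i \<in> J \<Longrightarrow> b i \<in> S i" "\<And>i. i \<in> J \<Longrightarrow> a i \<noteq> b i"
      by metis
    obtain c where c: "\<exists>i\<in>J. c i \<noteq> 0" "(\<Sum>i\<in>J. c i *\<^sub>R (a i - b i)) = 0"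
      using exists_linear_relation[of J "\<lambda>i. a i - b i"] \<open>finite J\<close> card unfolding J_def by blast
    \<comment> \<open>\<open>\<beta> i\<close> moves weight \<open>c i\<close> from
      \<open>b i\<close> to \<open>a i\<close>. Its entries sum to 0 over \<open>S i\<close>, and it
      changes the barycentre by \<open>c i *\<^sub>R (a i - b i)\<close>; by the choice of
      \<open>c\<close> these changes cancel over \<open>J\<close>.\<close>
    define \<beta> where "\<beta> i v = (if i \<in> J then (if v = a i then c i else 0) - (if v = b i then c i else 0) else 0)" for i v
    have \<beta>_sum: "sum (\<beta> i) (S i) = 0" if "i \<in> I" for i
      using fin[OF that] ab(1,2)[of i] by (cases "i \<in> J") (simp_all add: \<beta>_def sum_subtractf)
    have "(\<Sum>v\<in>S i. \<beta> i v *\<^sub>R v) = (if i \<in> J then c i *\<^sub>R (a i - b i) else 0)" if "i \<in> I" for i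
    proof (cases "i \<in> J")
      case True
      then have "\<beta> i v *\<^sub>R v = (if v = a i then c i *\<^sub>R v else 0) - (if v = b i then c i *\<^sub>R v else 0)" for v
        by (auto simp: \<beta>_def)
      then show ?thesis
        using fin[OF that] ab(1,2)[OF True] True by (simp add: sum_subtractf scaleR_diff_right)
    qed (simp add: \<beta>_def)
    then have "(\<Sum>i\<in>I. \<Sum>v\<in>S i. \<beta> i v *\<^sub>R v) = (\<Sum>i\<in>I. if i \<in> J then c i *\<^sub>R (a i - b i) else 0)"
      by (intro sum.cong) auto
    also have "\<dots> = 0"
      using c(2) \<open>J \<subseteq> I\<close> I by (simp add: sum.If_cases Int_absorb1)
    finally have \<beta>_bary: "(\<Sum>i\<in>I. \<Sum>v\<in>S i. \<beta> i v *\<^sub>R v) = 0" .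
    obtain k where k: "k \<in> J" "c k \<noteq> 0" using c(1) by blast
    \<comment> \<open>The two entries are \<open>c k\<close> and \<open>- c k\<close>, so one of
      them is the negative entry that \<open>positive_family_hits_zero\<close> asks for.\<close>
    then have "\<beta> k (a k) < 0 \<or> \<beta> k (b k) < 0" using ab(3)[of k] by (auto simp: \<beta>_def)
    then have "\<exists>x\<in>Sigma I S. \<beta> (fst x) (snd x) < 0"
    proof
      assume "\<beta> k (a k) < 0"
      then show ?thesis using k(1) ab(1)[OF k(1)] \<open>J \<subseteq> I\<close> by (intro bexI[of _ "(k, a k)"]) auto
    next
      assume "\<beta> k (b k) < 0"
      then show ?thesis using k(1) ab(2)[OF k(1)] \<open>J \<subseteq> I\<close> by (intro bexI[of _ "(k, b k)"]) auto
    qed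
    moreover have "finite (Sigma I S)" "\<And>x. x \<in> Sigma I S \<Longrightarrow> \<alpha> (fst x) (snd x) > 0"
      using I fin pos by auto
    ultimately obtain t x where x: "x \<in> Sigma I S" "\<alpha> (fst x) (snd x) + t * \<beta> (fst x) (snd x) = 0"
      and nn: "\<forall>y\<in>Sigma I S. \<alpha> (fst y) (snd y) + t * \<beta> (fst y) (snd y) \<ge> 0"
      using positive_family_hits_zero[of "Sigma I S" "\<lambda>x. \<alpha> (fst x) (snd x)" "\<lambda>x. \<beta> (fst x) (snd x)"]
      by blast
    obtain j p where jp: "j \<in> I" "p \<in> S j" "\<alpha> j p + t * \<beta> j p = 0"
      using x by (cases x) auto
    have nonneg: "\<alpha> i v + t * \<beta> i v \<ge> 0" if "i \<in> I" "v \<in> S i" for i v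
      using nn that by auto
    show ?thesis
    proof (rule *[OF jp(1,2), of "\<lambda>i v. \<alpha> i v + t * \<beta> i v"])
      show "(\<Sum>v\<in>S i. \<alpha> i v + t * \<beta> i v) = 1" if "i \<in> I" for i
        using \<alpha>(2)[OF that] \<beta>_sum[OF that] by (simp add: sum.distrib flip: sum_distrib_left)
      have "(\<Sum>i\<in>I. \<Sum>v\<in>S i. (\<alpha> i v + t * \<beta> i v) *\<^sub>R v) =
          (\<Sum>i\<in>I. \<Sum>v\<in>S i. \<alpha> i v *\<^sub>R v) + t *\<^sub>R (\<Sum>i\<in>I. \<Sum>v\<in>S i. \<beta> i v *\<^sub>R v)"
        by (simp add: scaleR_add_left sum.distrib scaleR_right.sum)
      then show "(\<Sum>i\<in>I. \<Sum>v\<in>S i. (\<alpha> i v + t * \<beta> i v) *\<^sub>R v) = (\<Sum>i\<in>I. z i)"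
        using \<alpha>(3) \<beta>_bary by simp
    qed (use jp nonneg in auto)
  qed
qed

text \<open>Caratheodory's theorem reduces the claim to finite sets. Points are then removed one at
  a time as long as more than \<open>DIM('a)\<close> sets fail to be singletons; the total number of
  points decreases, so this ends.\<close>

theorem shapley_folkman:
  fixes S :: "'i \<Rightarrow> 'a::euclidean_space set"
  assumes I: "finite I" and z: "\<And>i. i \<in> I \<Longrightarrow> z i \<in> convex hull S i"
  obtains S' z' where "\<And>i. i \<in> I \<Longrightarrow> S' i \<subseteq> S i" "\<And>i. i \<in> I \<Longrightarrow> z' i \<in> convex hull S' i"
    "(\<Sum>i\<in>I. z' i) = (\<Sum>i\<in>I. z i)" "card {i \<in> I. \<not> is_singleton (S' i)} \<le> DIM('a)"
proof -
  have finite_case: "\<exists>S' z'. (\<forall>i\<in>I. S' i \<subseteq> S i \<and> z' i \<in> convex hull S' i) \<and>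
      (\<Sum>i\<in>I. z' i) = (\<Sum>i\<in>I. z i) \<and> card {i \<in> I. \<not> is_singleton (S' i)} \<le> DIM('a)"
    if "\<And>i. i \<in> I \<Longrightarrow> finite (S i)" "\<And>i. i \<in> I \<Longrightarrow> z i \<in> convex hull S i" for S :: "'i \<Rightarrow> 'a set" and z
    using that
  proof (induction "\<Sum>i\<in>I. card (S i)" arbitrary: S z rule: less_induct)
    case less
    show ?case
    proof (cases "card {i \<in> I. \<not> is_singleton (S i)} \<le> DIM('a)")
      case True
      then show ?thesis using less.prems by blast
    next
      case False
      then have large: "card {i \<in> I. \<not> is_singleton (S i)} > DIM('a)" by simp
      obtain j p z' where jp: "j \<in> I" "p \<in> S j"
        and z': "\<And>i. i \<in> I \<Longrightarrow> z' i \<in> convex hull (S(j := S j - {p})) i" "(\<Sum>i\<in>I. z' i) = (\<Sum>i\<in>I. z i)"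
        by (rule shapley_folkman_step[OF I less.prems large]) auto
      have "card (S j - {p}) < card (S j)"
        using jp less.prems(1) by (intro card_Diff1_less) auto
      then have "(\<Sum>i\<in>I. card ((S(j := S j - {p})) i)) < (\<Sum>i\<in>I. card (S i))"
        using I jp(1) by (intro sum_strict_mono_ex1) auto
      moreover have "finite ((S(j := S j - {p})) i)" if "i \<in> I" for i
        using less.prems(1) that by auto
      ultimately have "\<exists>S' z''. (\<forall>i\<in>I. S' i \<subseteq> (S(j := S j - {p})) i \<and> z'' i \<in> convex hull S' i) \<and>
        (\<Sum>i\<in>I. z'' i) = (\<Sum>i\<in>I. z' i) \<and> card {i \<in> I. \<not> is_singleton (S' i)} \<le> DIM('a)"
        using z'(1) by (rule less.hyps)
      then obtain S' z'' where S': "\<forall>i\<in>I. S' i \<subseteq> (S(j := S j - {p})) i \<and> z'' i \<in> convex hull S' i"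
        "(\<Sum>i\<in>I. z'' i) = (\<Sum>i\<in>I. z' i)" "card {i \<in> I. \<not> is_singleton (S' i)} \<le> DIM('a)"
        by blast
      have "S' i \<subseteq> S i" if "i \<in> I" for i
        using S'(1) that by (auto split: if_splits)
      then show ?thesis using S' z'(2) by (intro exI[of _ S'] exI[of _ z'']) auto
    qed
  qed
  have "\<exists>R. finite R \<and> R \<subseteq> S i \<and> z i \<in> convex hull R" if "i \<in> I" for i
    using z[OF that] caratheodory[of "S i"] by auto
  then obtain R where R: "\<And>i. i \<in> I \<Longrightarrow> finite (R i)" "\<And>i. i \<in> I \<Longrightarrow> R i \<subseteq> S i" "\<And>i. i \<in> I \<Longrightarrow> z i \<in> convex hull R i"
    by metis
  have "\<exists>S' z'. (\<forall>i\<in>I. S' i \<subseteq> R i \<and> z' i \<in> convex hull S' i) \<and>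
      (\<Sum>i\<in>I. z' i) = (\<Sum>i\<in>I. z i) \<and> card {i \<in> I. \<not> is_singleton (S' i)} \<le> DIM('a)"
    using R(1,3) by (rule finite_case)
  then obtain S' z' where S': "\<forall>i\<in>I. S' i \<subseteq> R i \<and> z' i \<in> convex hull S' i"
      "(\<Sum>i\<in>I. z' i) = (\<Sum>i\<in>I. z i)" "card {i \<in> I. \<not> is_singleton (S' i)} \<le> DIM('a)"
    by (elim exE conjE)
  show thesis
    using S' R(2) by (intro that[of S' z']) blast+
qed

text \<open>The sets keep shrinking as \<open>N\<close> grows, so the bound for each partial sum, which holds for
  every selection from the sets at that stage, survives all later stages.\<close>

theorem barany_grinberg:
  fixes V :: "nat \<Rightarrow> 'a::euclidean_space set"
  assumes w: "\<And>i. i < N \<Longrightarrow> w i \<in> convex hull V i" and bd: "\<And>i. i < N \<Longrightarrow> V i \<subseteq> cball 0 K"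
    and "K \<ge> 0"
  shows "\<exists>v. (\<forall>i<N. v i \<in> V i) \<and>
    (\<forall>k\<le>N. norm ((\<Sum>i<k. v i) - (\<Sum>i<k. w i)) \<le> 2 * K * DIM('a))"
proof -
  \<comment> \<open>The induction carries sets \<open>S\<close> rather than a selection: all
    selections from them obey the bound for every \<open>k \<le> N\<close>, and \<open>z\<close>
    retains the sum of \<open>w\<close>, so that Shapley-Folkman can be applied again once the next
    set joins.\<close>
  have "\<exists>S z. (\<forall>i<N. S i \<subseteq> V i \<and> z i \<in> convex hull S i) \<and> (\<Sum>i<N. z i) = (\<Sum>i<N. w i) \<and>
    (\<forall>v. (\<forall>i<N. v i \<in> S i) \<longrightarrow> (\<forall>k\<le>N. norm ((\<Sum>i<k. v i) - (\<Sum>i<k. w i)) \<le> 2 * K * DIM('a)))"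
    (is "\<exists>S z. ?P N S z")
    using w bd
  proof (induction N)
    case 0
    then show ?case using \<open>K \<ge> 0\<close> by auto
  next
    case (Suc N)
    have "\<exists>S z. ?P N S z"
      by (rule Suc.IH) (use Suc.prems in auto)
    then obtain S z where IH: "?P N S z" by (elim exE)
    note S = IH[THEN conjunct1] IH[THEN conjunct2, THEN conjunct1] IH[THEN conjunct2, THEN conjunct2]
    \<comment> \<open>The new index enters with its full set \<open>V N\<close> and its original
      target \<open>w N\<close>; the earlier indices keep their shrunken sets.\<close>
    have hull: "(z(N := w N)) i \<in> convex hull (S(N := V N)) i" if "i \<in> {..<Suc N}" for i
      using that S(1) Suc.prems(1) by (auto simp: less_Suc_eq)
    obtain S' z' where S': "\<And>i. i < Suc N \<Longrightarrow> S' i \<subseteq> (S(N := V N)) i"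
      "\<And>i. i < Suc N \<Longrightarrow> z' i \<in> convex hull S' i"
      "(\<Sum>i<Suc N. z' i) = (\<Sum>i<Suc N. (z(N := w N)) i)"
      "card {i \<in> {..<Suc N}. \<not> is_singleton (S' i)} \<le> DIM('a)"
      by (rule shapley_folkman[of "{..<Suc N}" "z(N := w N)" "S(N := V N)", OF finite_lessThan hull]) auto
    have sum: "(\<Sum>i<Suc N. z' i) = (\<Sum>i<Suc N. w i)"
      using S'(3) S(2) by simp
    have SV: "S' i \<subseteq> V i" if "i < Suc N" for i
      using S'(1)[OF that] S(1) that by (cases "i = N") (auto simp: less_Suc_eq)
    have bound: "norm ((\<Sum>i<k. v i) - (\<Sum>i<k. w i)) \<le> 2 * K * DIM('a)"
      if v: "\<And>i. i < Suc N \<Longrightarrow> v i \<in> S' i" and "k \<le> Suc N" for v k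
    proof (cases "k \<le> N")
      case True
      have "v i \<in> S i" if "i < N" for i
        using v[of i] S'(1)[of i] that by auto
      then show ?thesis using True by (intro S(3)[rule_format])
    next
      case False
      then have "k = Suc N" using \<open>k \<le> Suc N\<close> by simp
      \<comment> \<open>Outside \<open>J\<close> the hull of \<open>S' i\<close> is a single point,
        which forces \<open>v i = z' i\<close>. Only the at most \<open>DIM('a)\<close> indices in
        \<open>J\<close> contribute, each with two vectors of norm at most \<open>K\<close>.\<close>
      define J where "J = {i \<in> {..<Suc N}. \<not> is_singleton (S' i)}"
      have "J \<subseteq> {..<Suc N}" by (auto simp: J_def)
      have "v i = z' i" if "i \<in> {..<Suc N} - J" for i
        using that v[of i] S'(2)[of i] by (auto simp: J_def elim!: is_singletonE)
      then have "(\<Sum>i<Suc N. v i - z' i) = (\<Sum>i\<in>J. v i - z' i)"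
        using \<open>J \<subseteq> {..<Suc N}\<close> by (intro sum.mono_neutral_right) auto
      then have "norm ((\<Sum>i<k. v i) - (\<Sum>i<k. w i)) = norm (\<Sum>i\<in>J. v i - z' i)"
        unfolding \<open>k = Suc N\<close> sum[symmetric] by (simp only: sum_subtractf)
      also have "\<dots> \<le> real (card J) * (2 * K)"
      proof (rule sum_norm_bound)
        fix i assume "i \<in> J"
        then have i: "i < Suc N" by (auto simp: J_def)
        have "convex hull S' i \<subseteq> cball 0 K"
          using SV[OF i] Suc.prems(2)[OF i] by (intro hull_minimal) auto
        then have "norm (z' i) \<le> K" using S'(2)[OF i] by auto
        moreover have "norm (v i) \<le> K" using v[OF i] SV[OF i] Suc.prems(2)[OF i] by auto
        ultimately show "norm (v i - z' i) \<le> 2 * K" using norm_triangle_ineq4[of "v i" "z' i"] by simp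
      qed
      also have "\<dots> \<le> DIM('a) * (2 * K)"
        using S'(4) \<open>K \<ge> 0\<close> unfolding J_def by (intro mult_right_mono) auto
      finally show ?thesis by (simp add: mult_ac)
    qed
    have "?P (Suc N) S' z'"
    proof (intro conjI allI impI)
      show "norm ((\<Sum>i<k. v i) - (\<Sum>i<k. w i)) \<le> 2 * K * DIM('a)"
        if "\<forall>i<Suc N. v i \<in> S' i" "k \<le> Suc N" for v k
        using that(1) by (intro bound[OF _ that(2)]) simp
    qed (fact SV S'(2) sum)+
    then show ?case by (intro exI)
  qed
  then obtain S z where S: "\<forall>i<N. S i \<subseteq> V i \<and> z i \<in> convex hull S i"
    and bound: "\<forall>v. (\<forall>i<N. v i \<in> S i) \<longrightarrow> (\<forall>k\<le>N. norm ((\<Sum>i<k. v i) - (\<Sum>i<k. w i)) \<le> 2 * K * DIM('a))"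
    by (elim exE conjE)
  define v where "v i = (SOME s. s \<in> S i)" for i
  have v: "v i \<in> S i" if "i < N" for i
  proof -
    have "S i \<noteq> {}" using S that by auto
    then show ?thesis unfolding v_def by (rule some_in_eq[THEN iffD2])
  qed
  show ?thesis
  proof (intro exI conjI allI impI)
    show "v i \<in> V i" if "i < N" for i using S v that by blast
    show "norm ((\<Sum>i<k. v i) - (\<Sum>i<k. w i)) \<le> 2 * K * DIM('a)" if "k \<le> N" for k
      using v that by (intro bound[rule_format])
  qed
qed

section \<open>Euler's scheme\<close>

lemma mem_plus_scale_cball:
  fixes c d :: "'a::real_normed_vector"
  assumes "r > 0" "d \<in> D" "norm (c - d) \<le> r"
  shows "c \<in> D + scale_set r (cball 0 1)"
proof -
  have "(c - d) /\<^sub>R r \<in> cball 0 1"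
    using assms by (simp add: divide_inverse_commute[symmetric] divide_le_eq del: scaleR_diff_right)
  then have "r *\<^sub>R ((c - d) /\<^sub>R r) \<in> scale_set r (cball 0 1)"
    unfolding scale_set_def by (rule imageI)
  then have "c - d \<in> scale_set r (cball 0 1)" using \<open>r > 0\<close> by simp
  then have "d + (c - d) \<in> D + scale_set r (cball 0 1)" using assms(2) by (rule set_plus_intro[rotated])
  then show ?thesis by simp
qed

text \<open>Every admissible radius \<open>r\<close> provides a point of \<open>D\<close> within
  \<open>r\<close> of \<open>c\<close>, and the closest point is at least as near; the infimum over
  \<open>r\<close> then inherits the bound.\<close>

lemma dist_closest_point_le_hausdorff_distance:
  fixes C D :: "'a::{real_inner,heine_borel} set"
  assumes "bounded C" "compact D" "D \<noteq> {}" "c \<in> C"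
  shows "dist c (closest_point D c) \<le> hausdorff_distance C D"
  unfolding hausdorff_distance_def
proof (rule cInf_greatest)
  \<comment> \<open>A lower bound passes to the infimum only if some radius is admissible. Both sets
    lie in the ball of radius \<open>R\<close>, so \<open>2 * R\<close> is one.\<close>
  obtain R where R: "R > 0" "\<And>z. z \<in> C \<union> D \<Longrightarrow> norm z \<le> R"
    using \<open>bounded C\<close> compact_imp_bounded[OF \<open>compact D\<close>] bounded_pos[of "C \<union> D"] by auto
  obtain d where "d \<in> D" using \<open>D \<noteq> {}\<close> by auto
  have near: "norm (u - v) \<le> 2 * R" if "u \<in> C \<union> D" "v \<in> C \<union> D" for u v
    using norm_triangle_ineq4[of u v] R(2)[OF that(1)] R(2)[OF that(2)] by simp
  have "C \<subseteq> D + scale_set (2 * R) (cball 0 1)" "D \<subseteq> C + scale_set (2 * R) (cball 0 1)"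
    using near R(1) \<open>d \<in> D\<close> \<open>c \<in> C\<close>
    by (auto intro: mem_plus_scale_cball[of _ d] mem_plus_scale_cball[of _ c])
  then show "{r. 0 \<le> r \<and> C \<subseteq> D + scale_set r (cball 0 1) \<and> D \<subseteq> C + scale_set r (cball 0 1)} \<noteq> {}"
    using R(1) by (auto intro!: exI[of _ "2 * R"])
next
  fix r assume "r \<in> {r. 0 \<le> r \<and> C \<subseteq> D + scale_set r (cball 0 1) \<and> D \<subseteq> C + scale_set r (cball 0 1)}"
  then have "r \<ge> 0" "c \<in> D + scale_set r (cball 0 1)" using \<open>c \<in> C\<close> by auto
  then obtain d b where db: "d \<in> D" "norm b \<le> 1" "c = d + r *\<^sub>R b"
    by (auto simp: set_plus_def scale_set_def)
  have "dist c (closest_point D c) \<le> dist c d"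
    using closest_point_exists(2)[OF compact_imp_closed[OF \<open>compact D\<close>] \<open>D \<noteq> {}\<close>] db(1) by blast
  also have "\<dots> = r * norm b" using db(3) \<open>r \<ge> 0\<close> by (simp add: dist_norm)
  also have "\<dots> \<le> r" using db(2) \<open>r \<ge> 0\<close> by (simp add: mult_left_le)
  finally show "dist c (closest_point D c) \<le> r" .
qed

text \<open>This turns the almost-everywhere condition of a solution into a
  \<open>negligible\<close> exceptional set, the form in which the mean value lemma takes
  it.\<close>

lemma AE_lebesgue_on_negligible:
  assumes "AE t in lebesgue_on S. P t" "S \<in> sets lebesgue"
  obtains E where "negligible E" "\<And>t. t \<in> S - E \<Longrightarrow> P t"
proof -
  obtain E where E: "{t \<in> space (lebesgue_on S). \<not> P t} \<subseteq> E"
    "emeasure (lebesgue_on S) E = 0" "E \<in> sets (lebesgue_on S)"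
    using assms(1) by (rule AE_E)
  then have "E \<in> null_sets (lebesgue_on S)" by auto
  then have "negligible E"
    using assms(2) by (simp add: negligible_iff_null_sets null_sets_restrict_space)
  with E(1) show thesis by (intro that[of E]) auto
qed

lemma discrete_gronwall:
  fixes e :: "nat \<Rightarrow> real"
  assumes "q \<ge> 0" "\<And>n. n \<le> N \<Longrightarrow> e n \<le> D + q * (\<Sum>k<n. e k)" "n \<le> N"
  shows "e n \<le> D * (1 + q) ^ n"
proof -
  \<comment> \<open>The induction runs on the majorant instead of \<open>e n\<close>, because the
    majorant grows by a factor of at most \<open>1 + q\<close> in each step.\<close>
  have "D + q * (\<Sum>k<n. e k) \<le> D * (1 + q) ^ n" if "n \<le> N" for n
    using that
  proof (induction n)
    case (Suc n)
    have "D + q * (\<Sum>k<Suc n. e k) = (D + q * (\<Sum>k<n. e k)) + q * e n"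
      by (simp add: algebra_simps)
    also have "\<dots> \<le> (D + q * (\<Sum>k<n. e k)) + q * (D + q * (\<Sum>k<n. e k))"
      using Suc.prems \<open>q \<ge> 0\<close> by (intro add_left_mono mult_left_mono assms(2)) auto
    also have "\<dots> = (1 + q) * (D + q * (\<Sum>k<n. e k))" by (simp add: algebra_simps)
    also have "\<dots> \<le> (1 + q) * (D * (1 + q) ^ n)"
      using Suc \<open>q \<ge> 0\<close> by (intro mult_left_mono) auto
    finally show ?case by (simp add: mult_ac)
  qed simp
  with assms(2)[OF \<open>n \<le> N\<close>] show ?thesis using \<open>n \<le> N\<close> by force
qed

section \<open>Mean slopes of a solution\<close>

text \<open>A solution has speed at most \<open>K\<close>, so on \<open>{s..t}\<close> it stays
  within \<open>K * (t - s)\<close> of \<open>x s\<close>. By the Lipschitz condition its velocities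
  lie within \<open>L * (K * (t - s))\<close> of \<open>F (x s)\<close>, hence in a closed convex
  neighbourhood of the hull, to which the mean slope then belongs as well.\<close>

lemma differential_inclusion_increments:
  fixes F :: "'a::euclidean_space \<Rightarrow> 'a set"
  assumes sol: "differential_inclusion_solution F x\<^sub>0 T x"
    and nonempty: "\<And>y. F y \<noteq> {}" and compact: "\<And>y. compact (F y)"
    and bd: "\<And>y. F y \<subseteq> cball 0 K"
    and lip: "\<And>y z. hausdorff_distance (F y) (F z) \<le> L * norm (y - z)"
    and "K \<ge> 0" "L \<ge> 0" "0 \<le> s" "s < t" "t \<le> T"
  obtains c where "c \<in> convex hull F (x s)"
    "norm ((x t - x s) /\<^sub>R (t - s) - c) \<le> L * (K * (t - s))"
proof -
  have ac: "abs_continuous_on_interval 0 T x"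
    and "AE t in lebesgue_on {0..T}. \<exists>v\<in>F (x t). (x has_vector_derivative v) (at t within {0..T})"
    using sol by (auto simp: differential_inclusion_solution_def)
  from this(2) obtain E where E: "negligible E"
    "\<And>t. t \<in> {0..T} - E \<Longrightarrow> \<exists>v\<in>F (x t). (x has_vector_derivative v) (at t within {0..T})"
    by (rule AE_lebesgue_on_negligible) auto
  \<comment> \<open>The right end \<open>u\<close> is left free: the speed bound uses all
    \<open>u\<close> up to \<open>T\<close>, the final argument only \<open>u = t\<close>.\<close>
  have der: "\<exists>v\<in>F (x r). (x has_vector_derivative v) (at r within {s..u})"
    if "r \<in> {s..u} - E" "u \<le> T" for r u
  proof -
    have "r \<in> {0..T} - E" "{s..u} \<subseteq> {0..T}" using that \<open>0 \<le> s\<close> by auto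
    with E(2)[of r] show ?thesis by (blast intro: has_vector_derivative_within_subset)
  qed
  have ac': "abs_continuous_on_interval s u x" if "u \<le> T" for u
    using ac \<open>0 \<le> s\<close> that by (rule abs_continuous_on_interval_subset)
  have speed: "norm (x u - x s) \<le> K * (u - s)" if "s \<le> u" "u \<le> T" for u
  proof (cases "s = u")
    case False
    have "(x u - x s) /\<^sub>R (u - s) \<in> cball 0 K"
    proof (rule abs_continuous_on_interval_mean_value[OF ac' _ E(1)])
      show "\<exists>v\<in>cball 0 K. (x has_vector_derivative v) (at r within {s..u})" if "r \<in> {s..u} - E" for r
        using der[OF that \<open>u \<le> T\<close>] bd by blast
    qed (use False that in auto)
    then show ?thesis using that False
      by (simp add: divide_inverse_commute[symmetric] divide_le_eq del: scaleR_diff_right)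
  qed simp
  define \<rho> where "\<rho> = L * (K * (t - s))"
  \<comment> \<open>\<open>C\<close> is the Minkowski sum of the hull and a ball. Both are compact
    and convex, so the sum is closed and convex, as the mean value lemma requires.\<close>
  define C where "C = (\<Union>c\<in>convex hull F (x s). \<Union>b\<in>cball 0 \<rho>. {c + b})"
  have "closed C" unfolding C_def
    by (intro compact_imp_closed compact_sums' compact_convex_hull compact compact_cball)
  have "convex C" unfolding C_def
    by (intro convex_sums convex_convex_hull convex_cball)
  have "(x t - x s) /\<^sub>R (t - s) \<in> C"
  proof (rule abs_continuous_on_interval_mean_value[OF ac'[OF \<open>t \<le> T\<close>] \<open>s < t\<close> E(1) \<open>closed C\<close> \<open>convex C\<close>])
    fix r assume r: "r \<in> {s..t} - E"
    then obtain v where v: "v \<in> F (x r)" "(x has_vector_derivative v) (at r within {s..t})"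
      using der \<open>t \<le> T\<close> by blast
    define w where "w = closest_point (F (x s)) v"
    have "w \<in> F (x s)"
      unfolding w_def by (intro closest_point_in_set compact_imp_closed compact nonempty)
    then have "w \<in> convex hull F (x s)" by (rule hull_inc)
    have "norm (v - w) \<le> hausdorff_distance (F (x r)) (F (x s))"
      unfolding w_def dist_norm[symmetric]
      by (intro dist_closest_point_le_hausdorff_distance compact_imp_bounded compact nonempty v(1))
    also have "\<dots> \<le> L * norm (x r - x s)" by (rule lip)
    also have "\<dots> \<le> L * (K * (r - s))"
      using r \<open>t \<le> T\<close> \<open>L \<ge> 0\<close> by (intro mult_left_mono speed) auto
    also have "\<dots> \<le> \<rho>"
      unfolding \<rho>_def using r \<open>L \<ge> 0\<close> \<open>K \<ge> 0\<close> by (intro mult_left_mono) auto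
    finally have "v - w \<in> cball 0 \<rho>" by simp
    moreover have "v = w + (v - w)" by simp
    ultimately have "v \<in> C" unfolding C_def using \<open>w \<in> convex hull F (x s)\<close> by blast
    then show "\<exists>v\<in>C. (x has_vector_derivative v) (at r within {s..t})" using v(2) by blast
  qed
  then obtain c b where cb: "c \<in> convex hull F (x s)" "norm b \<le> \<rho>" "(x t - x s) /\<^sub>R (t - s) = c + b"
    by (auto simp: C_def)
  then have "norm ((x t - x s) /\<^sub>R (t - s) - c) \<le> L * (K * (t - s))" by (simp add: \<rho>_def)
  with cb(1) show thesis by (rule that)
qed

section \<open>Construction of the Euler iterates and their error estimate\<close>

theorem theorem2p2:
  fixes F :: "real ^ 'd \<Rightarrow> (real ^ 'd) set"
    and x :: "real \<Rightarrow> real ^ 'd" and x\<^sub>0 :: "real ^ 'd"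
    and T K L \<Delta>t :: real and N :: nat
  assumes "T > 0" and "N > 0" and "\<Delta>t = T / real N"
    and "K \<ge> 0" and "L \<ge> 0"
    and "\<And>y. F y \<noteq> {}" and "\<And>y. compact (F y)"
    and "\<forall>y\<in>(\<Union>z. F z). norm y \<le> K"
    and "\<forall>y z. hausdorff_distance (F y) (F z) \<le> L * norm (y - z)"
    and "differential_inclusion_solution F x\<^sub>0 T x"
  shows "\<exists>\<xi> :: nat \<Rightarrow> real ^ 'd.
    forward_euler_solution F x\<^sub>0 \<Delta>t N \<xi> \<and>
    (MAX n\<in>{0..N}. norm (x (real n * \<Delta>t) - \<xi> n)) \<le>
      K * (exp (L * T) * real CARD('d) * (real CARD('d) + 1) + 2 * real CARD('d)
           + L * T * exp (L * T)) * \<Delta>t"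
proof -
  note [simp] = \<open>K \<ge> 0\<close> \<open>L \<ge> 0\<close>
  define h X d where "h = \<Delta>t" and "X n = x (real n * \<Delta>t)" and "d = real CARD('d)" for n :: nat
  have "h > 0" and hN: "real N * h = T" using assms(1-3) by (auto simp: h_def)
  have bd: "F y \<subseteq> cball 0 K" for y using assms(8) by auto
  have X0: "X 0 = x\<^sub>0" using assms(10) by (simp add: X_def differential_inclusion_solution_def)
  have "\<exists>c. c \<in> convex hull F (X n) \<and> norm ((X (Suc n) - X n) /\<^sub>R h - c) \<le> L * (K * h)"
    if "n < N" for n
  proof -
    have eq: "real (Suc n) * \<Delta>t - real n * \<Delta>t = h" by (simp add: h_def algebra_simps)
    have "real (Suc n) * h \<le> real N * h"
      using that \<open>h > 0\<close> by (intro mult_right_mono) auto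
    then have "real (Suc n) * \<Delta>t \<le> T" unfolding hN by (simp add: h_def)
    moreover have "0 \<le> real n * \<Delta>t" "real n * \<Delta>t < real (Suc n) * \<Delta>t"
      using \<open>h > 0\<close> by (auto simp: h_def)
    ultimately show ?thesis
      using differential_inclusion_increments[OF assms(10) assms(6,7) bd assms(9)[rule_format]
          \<open>K \<ge> 0\<close> \<open>L \<ge> 0\<close>, of "real n * \<Delta>t" "real (Suc n) * \<Delta>t"]
      unfolding eq X_def by blast
  qed
  then obtain c where c: "\<And>n. n < N \<Longrightarrow> c n \<in> convex hull F (X n)"
    "\<And>n. n < N \<Longrightarrow> norm ((X (Suc n) - X n) /\<^sub>R h - c n) \<le> L * (K * h)"
    by metis
  define r where "r n = (X (Suc n) - X n) /\<^sub>R h - c n" for n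
  have X_step: "X (Suc n) - X n = h *\<^sub>R (c n + r n)" for n
    using \<open>h > 0\<close> by (simp add: r_def)
  \<comment> \<open>The hull points \<open>c n\<close> need not be admissible velocities, but the
    points \<open>y n\<close> are, and they follow \<open>c n\<close> in all partial sums up to an
    error independent of \<open>N\<close>.\<close>
  have "\<exists>y. (\<forall>i<N. y i \<in> F (X i)) \<and>
      (\<forall>k\<le>N. norm ((\<Sum>i<k. y i) - (\<Sum>i<k. c i)) \<le> 2 * K * DIM(real ^ 'd))"
    using c(1) bd \<open>K \<ge> 0\<close> by (rule barany_grinberg)
  then obtain y where y: "\<forall>i<N. y i \<in> F (X i)"
    "\<forall>k\<le>N. norm ((\<Sum>i<k. y i) - (\<Sum>i<k. c i)) \<le> 2 * K * DIM(real ^ 'd)"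
    by (elim exE conjE)
  \<comment> \<open>Aiming at the fixed targets \<open>y n\<close> keeps the scheme close to the
    selection. Since \<open>F z\<close> is closed and non-empty, the closest point belongs to it
    whatever \<open>y n\<close> is, so the recursion makes sense for every \<open>n\<close>.\<close>
  define \<xi> where "\<xi> = rec_nat x\<^sub>0 (\<lambda>n z. z + h *\<^sub>R closest_point (F z) (y n))"
  define v where "v n = closest_point (F (\<xi> n)) (y n)" for n
  have \<xi>: "\<xi> 0 = x\<^sub>0" "\<xi> (Suc n) = \<xi> n + h *\<^sub>R v n" for n
    by (simp_all add: \<xi>_def v_def)
  have v_in: "v n \<in> F (\<xi> n)" for n
    unfolding v_def by (intro closest_point_in_set compact_imp_closed assms(6,7))
  have "\<xi> (Suc n) \<in> \<xi> n +o scale_set \<Delta>t (F (\<xi> n))" for n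
    unfolding \<xi>(2) h_def scale_set_def using v_in by (intro set_plus_intro2) blast
  then have euler: "forward_euler_solution F x\<^sub>0 \<Delta>t N \<xi>"
    by (simp add: forward_euler_solution_def \<xi>(1))
  have vy: "norm (v n - y n) \<le> L * norm (X n - \<xi> n)" if "n < N" for n
  proof -
    have "norm (v n - y n) = dist (y n) (closest_point (F (\<xi> n)) (y n))"
      by (simp add: v_def dist_norm norm_minus_commute)
    also have "\<dots> \<le> hausdorff_distance (F (X n)) (F (\<xi> n))"
      by (intro dist_closest_point_le_hausdorff_distance compact_imp_bounded assms(6,7) y(1)[rule_format] that)
    also have "\<dots> \<le> L * norm (X n - \<xi> n)" using assms(9) by blast
    finally show ?thesis .
  qed
  \<comment> \<open>\<open>2 * d\<close> accounts for the selection error; \<open>L * T\<close>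
    accounts for the mean slope errors, at most \<open>N\<close> of size \<open>L * (K * h)\<close>
    with \<open>real N * h = T\<close>.\<close>
  define D where "D = K * (2 * d + L * T) * h"
  have "D \<ge> 0" using \<open>T > 0\<close> \<open>h > 0\<close> by (simp add: D_def d_def)
  have err: "norm (X n - \<xi> n) \<le> D + h * L * (\<Sum>k<n. norm (X k - \<xi> k))" if "n \<le> N" for n
  proof -
    have "X n - \<xi> n = (\<Sum>i<n. (X (Suc i) - X i) - (\<xi> (Suc i) - \<xi> i))"
      using sum_lessThan_telescope[of "\<lambda>i. X i - \<xi> i" n] by (simp add: X0 \<xi>(1) algebra_simps)
    \<comment> \<open>The error splits into the slope defect \<open>r\<close>, the deviation
      \<open>v - y\<close> caused by evaluating \<open>F\<close> at the iterate, and the selection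
      error \<open>y - c\<close>. Only the middle one feeds back the earlier errors.\<close>
    also have "\<dots> = (\<Sum>i<n. h *\<^sub>R r i - h *\<^sub>R (v i - y i) - h *\<^sub>R (y i - c i))"
      by (simp add: X_step \<xi>(2) algebra_simps)
    also have "\<dots> = h *\<^sub>R ((\<Sum>i<n. r i) - (\<Sum>i<n. v i - y i) - ((\<Sum>i<n. y i) - (\<Sum>i<n. c i)))"
      by (simp only: sum_subtractf scaleR_diff_right scaleR_sum_right)
    finally have "norm (X n - \<xi> n) =
        h * norm ((\<Sum>i<n. r i) - (\<Sum>i<n. v i - y i) - ((\<Sum>i<n. y i) - (\<Sum>i<n. c i)))"
      using \<open>h > 0\<close> by simp
    also have "norm ((\<Sum>i<n. r i) - (\<Sum>i<n. v i - y i) - ((\<Sum>i<n. y i) - (\<Sum>i<n. c i))) \<le>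
        norm (\<Sum>i<n. r i) + norm (\<Sum>i<n. v i - y i) + norm ((\<Sum>i<n. y i) - (\<Sum>i<n. c i))"
      by (meson add_mono norm_triangle_ineq4 order_refl order_trans)
    also have "norm (\<Sum>i<n. r i) \<le> L * K * T"
    proof -
      have "norm (\<Sum>i<n. r i) \<le> real (card {..<n}) * (L * (K * h))"
        using c(2) that by (intro sum_norm_bound) (auto simp: r_def)
      also have "\<dots> \<le> real N * (L * (K * h))"
        using that \<open>h > 0\<close> by (intro mult_right_mono) auto
      also have "\<dots> = L * K * T" using hN by (simp add: mult_ac)
      finally show ?thesis .
    qed
    also have "norm (\<Sum>i<n. v i - y i) \<le> L * (\<Sum>i<n. norm (X i - \<xi> i))"
      unfolding sum_distrib_left using vy that by (intro sum_norm_le) auto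
    also have "norm ((\<Sum>i<n. y i) - (\<Sum>i<n. c i)) \<le> 2 * K * d"
      using y(2)[rule_format, OF that] by (simp add: d_def)
    finally show ?thesis
      using \<open>h > 0\<close> by (simp add: D_def algebra_simps)
  qed
  have "norm (X n - \<xi> n) \<le> K * (exp (L * T) * d * (d + 1) + 2 * d + L * T * exp (L * T)) * h"
    if "n \<le> N" for n
  proof -
    have "norm (X n - \<xi> n) \<le> D * (1 + h * L) ^ n"
      using \<open>h > 0\<close> err that by (intro discrete_gronwall) auto
    also have "\<dots> \<le> D * exp (L * T)"
    proof (intro mult_left_mono \<open>D \<ge> 0\<close>)
      have "(1 + h * L) ^ n \<le> exp (h * L) ^ n"
        using \<open>h > 0\<close> by (intro power_mono exp_ge_add_one_self) auto
      also have "\<dots> \<le> exp (h * L) ^ N"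
        using that \<open>h > 0\<close> by (intro power_increasing) auto
      also have "\<dots> = exp (L * T)"
        by (simp add: hN[symmetric] mult_ac flip: exp_of_nat_mult)
      finally show "(1 + h * L) ^ n \<le> exp (L * T)" .
    qed
    also have "\<dots> = K * (2 * d * exp (L * T) + L * T * exp (L * T)) * h"
      by (simp add: D_def algebra_simps)
    also have "\<dots> \<le> K * (exp (L * T) * d * (d + 1) + 2 * d + L * T * exp (L * T)) * h"
    proof (intro mult_right_mono mult_left_mono add_right_mono)
      \<comment> \<open>The Gronwall estimate yields the factor \<open>2 * d\<close>; it is absorbed
        into \<open>d * (d + 1)\<close> because \<open>2 \<le> d + 1\<close>.\<close>
      have "d \<ge> 1" by (simp add: d_def Suc_leI)
      have "2 * d * exp (L * T) = exp (L * T) * d * 2" by simp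
      also have "\<dots> \<le> exp (L * T) * d * (d + 1)"
        using \<open>d \<ge> 1\<close> by (intro mult_left_mono) auto
      also have "\<dots> \<le> exp (L * T) * d * (d + 1) + 2 * d"
        using \<open>d \<ge> 1\<close> by simp
      finally show "2 * d * exp (L * T) \<le> exp (L * T) * d * (d + 1) + 2 * d" .
    qed (use \<open>h > 0\<close> in auto)
    finally show ?thesis .
  qed
  then have "(MAX n\<in>{0..N}. norm (x (real n * \<Delta>t) - \<xi> n)) \<le>
      K * (exp (L * T) * d * (d + 1) + 2 * d + L * T * exp (L * T)) * \<Delta>t"
    by (subst Max_le_iff) (auto simp: X_def h_def)
  with euler show ?thesis unfolding d_def by blast
qed

end
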